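(* Let $G$ be a $6$-regular $(4,1)$-graph, let $A$ be a shore of a nontrivial $6$-edge-cut of $G$, and let $H=G[A]$. Suppose $A$ is concentrated on two distinct vertices $p,\ell\in A$, i.e. $b(p)=b(\ell)=3$ and $b(v)=0$ for all $v\in A\setminus\{p,\ell\}$. Then $\alpha(p)=\alpha(\ell)$ for every proper $3$-colouring $\alpha$ of $H$; equivalently, $p\ell\notin E(H)$ and the graph $H+p\ell$ is not $3$-colourable.
   Context: All graphs are finite and simple. A $(4,1)$-graph is a graph $G$ with $\chi(G)=4$, $\chi(G-v)=3$ for every vertex $v$, and $\chi(G-e)=4$ for every edge $e$. For a partition $V(G)=A\sqcup B$ with $A,B$ nonempty, the edge cut is the set $E(A,B)$ of edges with one end in $A$ and one in $B$; it is a $6$-edge-cut if $|E(A,B)|=6$, and $A$ and $B$ are its shores. A $6$-edge-cut is trivial if it is the set of all edges incident to a single vertex, and nontrivial otherwise (so both shores have at least two vertices). For $v\in A$, $b(v)=6-d_{G[A]}(v)$ is the number of cut edges at $v$. $H+p\ell$ denotes $H$ with the edge $p\ell$ added. Proper $3$-colourings are maps to $\{1,2,3\}$. *)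

theory Defs
  imports Main
begin

text \<open>Graphs are given by a vertex set and a set of two-element edges. As records are
  unconstrained, finiteness and simplicity are the predicate \<open>fin_simple_graph\<close>.\<close>

record 'a ugraph =
  verts :: "'a set"
  edges :: "'a set set"

definition fin_simple_graph :: "'a ugraph \<Rightarrow> bool" where
  "fin_simple_graph G \<longleftrightarrow>
     finite (verts G) \<and> (\<forall>e\<in>edges G. e \<subseteq> verts G \<and> card e = 2)"

definition incident_edges :: "'a ugraph \<Rightarrow> 'a \<Rightarrow> 'a set set" where
  "incident_edges G v = {e \<in> edges G. v \<in> e}"

definition degree :: "'a ugraph \<Rightarrow> 'a \<Rightarrow> nat" where
  "degree G v = card (incident_edges G v)"

definition regular :: "nat \<Rightarrow> 'a ugraph \<Rightarrow> bool" where
  "regular k G \<longleftrightarrow> (\<forall>v\<in>verts G. degree G v = k)"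

definition induced_subgraph :: "'a ugraph \<Rightarrow> 'a set \<Rightarrow> 'a ugraph" where
  "induced_subgraph G A = \<lparr>verts = A, edges = {e \<in> edges G. e \<subseteq> A}\<rparr>"

definition delete_vertex :: "'a ugraph \<Rightarrow> 'a \<Rightarrow> 'a ugraph" where
  "delete_vertex G v = induced_subgraph G (verts G - {v})"

definition delete_edge :: "'a ugraph \<Rightarrow> 'a set \<Rightarrow> 'a ugraph" where
  "delete_edge G e = \<lparr>verts = verts G, edges = edges G - {e}\<rparr>"

definition add_edge :: "'a ugraph \<Rightarrow> 'a \<Rightarrow> 'a \<Rightarrow> 'a ugraph" where
  "add_edge G u v = \<lparr>verts = verts G, edges = insert {u, v} (edges G)\<rparr>"

text \<open>Only the values of a colouring on the vertices of the graph matter; it is an arbitrary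
  total function elsewhere.\<close>

definition proper_colouring :: "'a ugraph \<Rightarrow> nat \<Rightarrow> ('a \<Rightarrow> nat) \<Rightarrow> bool" where
  "proper_colouring G k c \<longleftrightarrow>
     (\<forall>v\<in>verts G. c v \<in> {1..k}) \<and> (\<forall>u v. {u, v} \<in> edges G \<longrightarrow> c u \<noteq> c v)"

definition colourable :: "'a ugraph \<Rightarrow> nat \<Rightarrow> bool" where
  "colourable G k \<longleftrightarrow> (\<exists>c. proper_colouring G k c)"

text \<open>Well defined for every finite simple graph, since such a graph is colourable with
  as many colours as it has vertices.\<close>

definition chromatic_number :: "'a ugraph \<Rightarrow> nat" where
  "chromatic_number G = (LEAST k. colourable G k)"

definition four_one_graph :: "'a ugraph \<Rightarrow> bool" where
  "four_one_graph G \<longleftrightarrow>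
     fin_simple_graph G \<and>
     chromatic_number G = 4 \<and>
     (\<forall>v\<in>verts G. chromatic_number (delete_vertex G v) = 3) \<and>
     (\<forall>e\<in>edges G. chromatic_number (delete_edge G e) = 4)"

definition edge_cut :: "'a ugraph \<Rightarrow> 'a set \<Rightarrow> 'a set \<Rightarrow> 'a set set" where
  "edge_cut G A B = {e \<in> edges G. \<exists>a\<in>A. \<exists>b\<in>B. e = {a, b}}"

definition trivial_cut :: "'a ugraph \<Rightarrow> 'a set set \<Rightarrow> bool" where
  "trivial_cut G C \<longleftrightarrow> (\<exists>v\<in>verts G. C = incident_edges G v)"

definition nontrivial_6_edge_cut_shore :: "'a ugraph \<Rightarrow> 'a set \<Rightarrow> bool" where
  "nontrivial_6_edge_cut_shore G A \<longleftrightarrow>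
     (\<exists>B. A \<union> B = verts G \<and> A \<inter> B = {} \<and> A \<noteq> {} \<and> B \<noteq> {} \<and>
          card (edge_cut G A B) = 6 \<and> \<not> trivial_cut G (edge_cut G A B))"

text \<open>Integer valued, so that the subtraction is not truncated.\<close>

definition boundary :: "'a ugraph \<Rightarrow> 'a set \<Rightarrow> 'a \<Rightarrow> int" where
  "boundary G A v = 6 - int (degree (induced_subgraph G A) v)"

definition concentrated_on :: "'a ugraph \<Rightarrow> 'a set \<Rightarrow> 'a \<Rightarrow> 'a \<Rightarrow> bool" where
  "concentrated_on G A p l \<longleftrightarrow>
     p \<in> A \<and> l \<in> A \<and> p \<noteq> l \<and> boundary G A p = 3 \<and> boundary G A l = 3 \<and>
     (\<forall>v\<in>A - {p, l}. boundary G A v = 0)"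

end

theory Submission
  imports Defs "HOL-Combinatorics.Transposition"
begin

text \<open>Suppose that some 3-colouring \<open>\<alpha>\<close> of \<open>H\<close> separates \<open>p\<close> from \<open>l\<close>. By vertex-criticality
  \<open>G - p\<close> has a 3-colouring \<open>c\<close>. Keep \<open>c\<close> on the opposite shore and colour \<open>A\<close> by \<open>\<alpha>\<close> with its
  colours permuted so that \<open>l\<close> receives \<open>c l\<close>. Then no cut edge at \<open>l\<close> is monochromatic,
  because \<open>c\<close> was proper at \<open>l\<close>, so every conflict lies on one of the three cut edges at \<open>p\<close>.
  As \<open>\<alpha> p \<noteq> \<alpha> l\<close>, the permutation may still send \<open>p\<close> to either of the two colours other than
  \<open>c l\<close>; the conflicts of these two choices are disjoint sets of cut edges at \<open>p\<close>, so one choice has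
  at most one conflict (\<open>two_colours_one_conflict\<close>). But no colouring of a \<open>(4,1)\<close>-graph with three
  colours has fewer than two conflicts, since neither \<open>G\<close> nor \<open>G\<close> minus an edge is 3-colourable
  (\<open>two_monochromatic_edges\<close>).

  Hence \<open>p\<close> and \<open>l\<close> agree in every 3-colouring of \<open>H\<close>. The formulation with \<open>H + pl\<close> follows
  because \<open>H\<close> does have 3-colourings, inherited from \<open>G - v\<close> with \<open>v\<close> on the opposite shore.\<close>

section \<open>Chromatic number and recolouring\<close>

lemma not_colourable_below_chromatic_number:
  "k < chromatic_number G \<Longrightarrow> \<not> colourable G k"
  unfolding chromatic_number_def by (rule not_less_Least)

text \<open>An injective numbering of the vertices is a proper colouring, so the least number of colours
  is attained.\<close>

lemma colourable_chromatic_number: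
  assumes "fin_simple_graph G"
  shows "colourable G (chromatic_number G)"
proof -
  let ?n = "card (verts G)"
  have "finite (verts G)" using assms by (simp add: fin_simple_graph_def)
  then obtain f where f: "bij_betw f (verts G) {1..?n}"
    using finite_same_card_bij[of "verts G" "{1..?n}"] by auto
  have "f u \<noteq> f v" if "{u, v} \<in> edges G" for u v
  proof -
    have uv: "{u, v} \<subseteq> verts G" "card {u, v} = 2"
      using assms that unfolding fin_simple_graph_def by blast+
    then have "u \<noteq> v" by (intro notI) simp
    then show ?thesis
      using uv(1) inj_onD[OF bij_betw_imp_inj_on[OF f], of u v] by (intro notI) simp
  qed
  then have "proper_colouring G ?n f"
    using bij_betwE[OF f] by (simp add: proper_colouring_def)
  then have "colourable G ?n"
    unfolding colourable_def by blast
  then show ?thesis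
    unfolding chromatic_number_def by (rule LeastI)
qed

lemma fin_simple_graph_delete_vertex:
  "fin_simple_graph G \<Longrightarrow> fin_simple_graph (delete_vertex G v)"
  by (auto simp: fin_simple_graph_def delete_vertex_def induced_subgraph_def)

lemma proper_colouring_induced_subgraph_mono:
  assumes "proper_colouring (induced_subgraph G B) k c" and "A \<subseteq> B"
  shows "proper_colouring (induced_subgraph G A) k c"
  unfolding proper_colouring_def
proof (intro conjI ballI allI impI)
  fix v assume "v \<in> verts (induced_subgraph G A)"
  then show "c v \<in> {1..k}"
    using assms subsetD[OF assms(2)] by (simp add: proper_colouring_def induced_subgraph_def)
next
  fix u v assume "{u, v} \<in> edges (induced_subgraph G A)"
  then have "{u, v} \<in> edges (induced_subgraph G B)"
    using subsetD[OF assms(2)] by (simp add: induced_subgraph_def)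
  then show "c u \<noteq> c v"
    using assms(1) by (simp add: proper_colouring_def)
qed

lemma proper_colouring_permute:
  assumes "fin_simple_graph G" and "proper_colouring G k c" and "bij_betw \<sigma> {1..k} {1..k}"
  shows "proper_colouring G k (\<sigma> \<circ> c)"
  unfolding proper_colouring_def
proof (intro conjI ballI allI impI)
  fix v assume "v \<in> verts G"
  then show "(\<sigma> \<circ> c) v \<in> {1..k}"
    using assms(2) bij_betwE[OF assms(3)] unfolding proper_colouring_def o_def by blast
next
  fix u v assume e: "{u, v} \<in> edges G"
  then have "{u, v} \<subseteq> verts G" using assms(1) unfolding fin_simple_graph_def by blast
  then have "c u \<in> {1..k}" "c v \<in> {1..k}" "c u \<noteq> c v"
    using assms(2) e unfolding proper_colouring_def by blast+
  then show "(\<sigma> \<circ> c) u \<noteq> (\<sigma> \<circ> c) v"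
    using assms(3) unfolding bij_betw_def inj_on_def o_def by blast
qed

lemma exists_bij_with_two_values:
  assumes "a \<in> S" "b \<in> S" "x \<in> S" "y \<in> S" and "a \<noteq> b" "x \<noteq> y"
  obtains \<sigma> where "bij_betw \<sigma> S S" "\<sigma> a = x" "\<sigma> b = y"
proof
  \<comment> \<open>The second transposition moves the image of \<open>b\<close> to \<open>y\<close>; it fixes \<open>x\<close>, as \<open>x\<close> differs from
    both.\<close>
  let ?\<tau> = "transpose a x"
  let ?\<sigma> = "transpose (?\<tau> b) y \<circ> ?\<tau>"
  have "?\<tau> b \<in> S" using assms by (auto simp: transpose_def)
  then show "bij_betw ?\<sigma> S S"
    using assms by (intro bij_betw_trans[of _ S S]) auto
  show "?\<sigma> a = x" "?\<sigma> b = y"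
    using assms by (auto simp: transpose_def)
qed

section \<open>Conflicts of an improper colouring\<close>

definition monochromatic_edges :: "'a ugraph \<Rightarrow> ('a \<Rightarrow> nat) \<Rightarrow> 'a set set" where
  "monochromatic_edges G c = {e \<in> edges G. \<exists>u v. e = {u, v} \<and> c u = c v}"

text \<open>A colouring whose only conflict is at \<open>e\<close> is a proper colouring of \<open>G - e\<close>.\<close>

lemma two_monochromatic_edges:
  assumes "\<not> colourable G k"
    and "\<And>e. e \<in> edges G \<Longrightarrow> \<not> colourable (delete_edge G e) k"
    and range: "\<And>v. v \<in> verts G \<Longrightarrow> c v \<in> {1..k}"
    and "finite (monochromatic_edges G c)"
  shows "2 \<le> card (monochromatic_edges G c)"
proof (rule ccontr)
  let ?M = "monochromatic_edges G c"
  assume "\<not> 2 \<le> card ?M"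
  then consider "card ?M = 0" | "card ?M = 1" by linarith
  then show False
  proof cases
    case 1
    then have "?M = {}" using assms(4) by simp
    then have "proper_colouring G k c"
      using range unfolding proper_colouring_def monochromatic_edges_def by blast
    then show False using assms(1) unfolding colourable_def by blast
  next
    case 2
    then obtain e where M: "?M = {e}" by (auto simp: card_1_singleton_iff)
    then have e: "e \<in> edges G" by (auto simp: monochromatic_edges_def)
    have "c u \<noteq> c v" if "{u, v} \<in> edges G - {e}" for u v
    proof
      assume "c u = c v"
      then have "{u, v} \<in> ?M" using that by (auto simp only: monochromatic_edges_def)
      then show False using that M by simp
    qed
    then have "proper_colouring (delete_edge G e) k c"
      using range unfolding proper_colouring_def delete_edge_def by simp
    then show False using assms(2)[OF e] unfolding colourable_def by blast
  qed
qed

definition cut_edges_at :: "'a ugraph \<Rightarrow> 'a set \<Rightarrow> 'a \<Rightarrow> 'a set set" where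
  "cut_edges_at G A v = {e \<in> incident_edges G v. \<not> e \<subseteq> A}"

lemma finite_edges: "fin_simple_graph G \<Longrightarrow> finite (edges G)"
  by (rule finite_subset[of _ "Pow (verts G)"]) (auto simp: fin_simple_graph_def)

lemma boundary_eq_card_cut_edges_at:
  assumes "fin_simple_graph G" "regular 6 G" "v \<in> verts G"
  shows "boundary G A v = int (card (cut_edges_at G A v))"
proof -
  let ?I = "incident_edges (induced_subgraph G A) v"
  have fin: "finite (incident_edges G v)"
    using finite_edges[OF assms(1)] by (simp add: incident_edges_def)
  have I: "?I = {e \<in> incident_edges G v. e \<subseteq> A}"
    by (simp add: incident_edges_def induced_subgraph_def conj_ac)
  then have "?I \<subseteq> incident_edges G v" "cut_edges_at G A v = incident_edges G v - ?I"
    unfolding I cut_edges_at_def by blast+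
  then have "card (cut_edges_at G A v) + card ?I = card (incident_edges G v)"
    using fin by (simp add: card_Diff_subset card_mono finite_subset)
  moreover have "card (incident_edges G v) = 6"
    using assms by (simp add: regular_def degree_def)
  ultimately show ?thesis
    by (simp add: boundary_def degree_def)
qed

text \<open>Each cut edge at \<open>p\<close> conflicts with only one colour of \<open>p\<close>, so with at most three such edges
  two colours cannot both have two conflicts.\<close>

lemma two_colours_one_conflict:
  assumes "finite (cut_edges_at G A p)" "card (cut_edges_at G A p) \<le> 3"
    and "p \<in> A" and "x \<noteq> y"
  obtains i where "i \<in> {x, y}"
    and "card {e \<in> cut_edges_at G A p. \<exists>w. w \<notin> A \<and> e = {p, w} \<and> c w = i} \<le> 1"
proof -
  let ?X = "\<lambda>i. {e \<in> cut_edges_at G A p. \<exists>w. w \<notin> A \<and> e = {p, w} \<and> c w = i}"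
  have "?X x \<inter> ?X y = {}" using assms by (auto simp: doubleton_eq_iff)
  then have "card (?X x) + card (?X y) = card (?X x \<union> ?X y)"
    using assms(1) by (simp add: card_Un_disjoint)
  also have "\<dots> \<le> card (cut_edges_at G A p)"
    using assms(1) by (intro card_mono) auto
  finally have "card (?X x) \<le> 1 \<or> card (?X y) \<le> 1" using assms(2) by linarith
  then show thesis using that by blast
qed

text \<open>When the colouring of \<open>A\<close> is glued to that of \<open>G - p\<close> on the opposite shore, conflicts occur
  only across the cut, and at \<open>l\<close> they are excluded because \<open>l\<close> has the colour it had in
  \<open>G - p\<close>.\<close>

lemma glued_conflicts_at_one_vertex:
  fixes a c :: "'a \<Rightarrow> nat"
  assumes G: "fin_simple_graph G"
    and a: "proper_colouring (induced_subgraph G A) k a"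
    and c: "proper_colouring (delete_vertex G p) k c"
    and pl: "p \<in> A" "l \<in> A" "p \<noteq> l" and agree: "a l = c l"
    and cut: "\<And>v. v \<in> A - {p, l} \<Longrightarrow> cut_edges_at G A v = {}"
  shows "monochromatic_edges G (\<lambda>v. if v \<in> A then a v else c v)
    \<subseteq> {e \<in> cut_edges_at G A p. \<exists>w. w \<notin> A \<and> e = {p, w} \<and> c w = a p}"
proof
  let ?g = "\<lambda>v. if v \<in> A then a v else c v"
  have a_ne: "a u \<noteq> a v" if "{u, v} \<in> edges G" "{u, v} \<subseteq> A" for u v
    using a that by (simp add: proper_colouring_def induced_subgraph_def)
  have c_ne: "c u \<noteq> c v" if "{u, v} \<in> edges G" "{u, v} \<subseteq> verts G - {p}" for u v
    using c that by (simp add: proper_colouring_def delete_vertex_def induced_subgraph_def)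
  fix e assume "e \<in> monochromatic_edges G ?g"
  then obtain u0 v0 where e: "e \<in> edges G" and e0: "e = {u0, v0}" and "?g u0 = ?g v0"
    by (auto simp: monochromatic_edges_def)
  have V: "{u0, v0} \<subseteq> verts G" using G e e0 unfolding fin_simple_graph_def by blast
  have "\<not> (u0 \<in> A \<and> v0 \<in> A)"
    using a_ne[of u0 v0] e e0 \<open>?g u0 = ?g v0\<close> by (simp split: if_splits)
  moreover have "\<not> (u0 \<notin> A \<and> v0 \<notin> A)"
  proof
    assume out: "u0 \<notin> A \<and> v0 \<notin> A"
    then have "{u0, v0} \<subseteq> verts G - {p}" using V \<open>p \<in> A\<close> by blast
    then have "c u0 \<noteq> c v0" using c_ne[of u0 v0] e e0 by simp
    then show False using out \<open>?g u0 = ?g v0\<close> by simp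
  qed
  ultimately have one: "u0 \<in> A \<longleftrightarrow> v0 \<notin> A" by blast
  obtain u w where uw: "u \<in> A" "w \<notin> A" "e = {u, w}" "?g u = ?g w"
  proof (cases "u0 \<in> A")
    case True
    then show thesis using that[of u0 v0] one e0 \<open>?g u0 = ?g v0\<close> by simp
  next
    case False
    have "e = {v0, u0}" unfolding e0 by (rule insert_commute)
    then show thesis using that[of v0 u0] one False \<open>?g u0 = ?g v0\<close> by simp
  qed
  then have eq: "a u = c w" by simp
  have cu: "e \<in> cut_edges_at G A u"
    using e uw(2,3) by (simp add: cut_edges_at_def incident_edges_def)
  have "u \<noteq> l"
  proof
    assume "u = l"
    have "{l, w} \<subseteq> verts G" using V e0 uw(3) \<open>u = l\<close> by simp
    then have "{l, w} \<subseteq> verts G - {p}" using uw(2) pl by blast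
    then have "c l \<noteq> c w"
      using c_ne[of l w] e uw(3) \<open>u = l\<close> by simp
    then show False using eq \<open>u = l\<close> agree by simp
  qed
  then have "u = p" using cut[of u] cu uw(1) by blast
  then show "e \<in> {e \<in> cut_edges_at G A p. \<exists>w. w \<notin> A \<and> e = {p, w} \<and> c w = a p}"
    using cu uw(2,3) eq by (intro CollectI conjI exI[of _ w]) simp_all
qed

section \<open>Shores concentrated on two vertices\<close>

theorem corollary6p3:
  fixes G H :: "'a ugraph" and A :: "'a set" and p l :: 'a
  assumes "four_one_graph G"
    and "regular 6 G"
    and "nontrivial_6_edge_cut_shore G A"
    and "H = induced_subgraph G A"
    and "concentrated_on G A p l"
  shows "(\<forall>\<alpha>. proper_colouring H 3 \<alpha> \<longrightarrow> \<alpha> p = \<alpha> l) \<and>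
    ((\<forall>\<alpha>. proper_colouring H 3 \<alpha> \<longrightarrow> \<alpha> p = \<alpha> l) \<longleftrightarrow>
      {p, l} \<notin> edges H \<and> \<not> colourable (add_edge H p l) 3)"
proof -
  have G: "fin_simple_graph G" using assms(1) by (simp add: four_one_graph_def)
  obtain b where AV: "A \<subseteq> verts G" and b: "b \<in> verts G" "b \<notin> A"
    using assms(3) unfolding nontrivial_6_edge_cut_shore_def by blast
  have pl: "p \<in> A" "l \<in> A" "p \<noteq> l"
    using assms(5) by (auto simp: concentrated_on_def)
  have H: "fin_simple_graph H"
    using G AV assms(4) by (auto simp: fin_simple_graph_def induced_subgraph_def finite_subset)
  have finS: "finite (cut_edges_at G A v)" for v
    using finite_edges[OF G] by (simp add: cut_edges_at_def incident_edges_def)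
  have bd: "boundary G A v = int (card (cut_edges_at G A v))" if "v \<in> A" for v
    using boundary_eq_card_cut_edges_at[OF G assms(2)] that AV by blast
  have card_p: "card (cut_edges_at G A p) = 3"
    using bd[OF pl(1)] assms(5) by (simp add: concentrated_on_def)
  have cut: "cut_edges_at G A v = {}" if "v \<in> A - {p, l}" for v
    using bd[of v] that assms(5) finS[of v] by (simp add: concentrated_on_def)
  have three: "\<exists>c. proper_colouring (delete_vertex G v) 3 c" if "v \<in> verts G" for v
    using colourable_chromatic_number[OF fin_simple_graph_delete_vertex[OF G], of v] that assms(1)
    by (simp add: four_one_graph_def colourable_def)

  have same: "\<alpha> p = \<alpha> l" if \<alpha>: "proper_colouring H 3 \<alpha>" for \<alpha>
  proof (rule ccontr)
    assume ne: "\<alpha> p \<noteq> \<alpha> l"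
    obtain c where c: "proper_colouring (delete_vertex G p) 3 c"
      using three pl(1) AV by blast
    have c_range: "c v \<in> {1..3}" if "v \<in> verts G - {p}" for v
      using c that by (simp add: proper_colouring_def delete_vertex_def induced_subgraph_def)
    have cl: "c l \<in> {1..3}" using c_range pl AV by blast
    \<comment> \<open>Once \<open>l\<close> has the colour \<open>c l\<close>, a permutation of \<open>\<alpha>\<close> may give \<open>p\<close> either of the
      other two.\<close>
    have "card ({1..3} - {c l}) = 2" using cl by simp
    then obtain x y where xy: "{1..3} - {c l} = {x, y}" "x \<noteq> y"
      by (auto simp: card_2_iff)
    obtain i where i: "i \<in> {x, y}"
      and few: "card {e \<in> cut_edges_at G A p. \<exists>w. w \<notin> A \<and> e = {p, w} \<and> c w = i} \<le> 1"
      by (rule two_colours_one_conflict[OF finS _ pl(1) xy(2), where c = c]) (use card_p in auto)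
    have ran: "\<alpha> l \<in> {1..3}" "\<alpha> p \<in> {1..3}"
      using \<alpha> assms(4) pl by (simp_all add: proper_colouring_def induced_subgraph_def)
    have ran_i: "i \<in> {1..3}" "c l \<noteq> i" using i xy(1) by blast+
    obtain \<sigma> where \<sigma>: "bij_betw \<sigma> {1..3} {1..3}" "\<sigma> (\<alpha> l) = c l" "\<sigma> (\<alpha> p) = i"
      using exists_bij_with_two_values[OF ran cl ran_i(1) ne[symmetric] ran_i(2)] by blast
    define g where "g = (\<lambda>v. if v \<in> A then (\<sigma> \<circ> \<alpha>) v else c v)"
    have a: "proper_colouring (induced_subgraph G A) 3 (\<sigma> \<circ> \<alpha>)"
      using proper_colouring_permute[OF H \<alpha> \<sigma>(1)] assms(4) by simp
    have "monochromatic_edges G g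
        \<subseteq> {e \<in> cut_edges_at G A p. \<exists>w. w \<notin> A \<and> e = {p, w} \<and> c w = (\<sigma> \<circ> \<alpha>) p}"
      unfolding g_def using \<sigma>(2) cut
      by (intro glued_conflicts_at_one_vertex[OF G a c pl]) auto
    then have "card (monochromatic_edges G g)
        \<le> card {e \<in> cut_edges_at G A p. \<exists>w. w \<notin> A \<and> e = {p, w} \<and> c w = i}"
      using finS \<sigma>(3) by (intro card_mono) simp_all
    moreover have "2 \<le> card (monochromatic_edges G g)"
    proof (rule two_monochromatic_edges)
      show "\<not> colourable G 3"
        using assms(1) by (intro not_colourable_below_chromatic_number) (simp add: four_one_graph_def)
      show "\<not> colourable (delete_edge G e) 3" if "e \<in> edges G" for e
        using assms(1) that
        by (intro not_colourable_below_chromatic_number) (simp add: four_one_graph_def)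
      show "g v \<in> {1..3}" if "v \<in> verts G" for v
        using a c_range[of v] that pl(1)
        by (auto simp: g_def proper_colouring_def induced_subgraph_def)
      show "finite (monochromatic_edges G g)"
        using finite_edges[OF G] by (simp add: monochromatic_edges_def)
    qed
    ultimately show False using few by linarith
  qed

  obtain \<beta> where "proper_colouring (delete_vertex G b) 3 \<beta>" using three b by blast
  then have \<beta>: "proper_colouring H 3 \<beta>"
    using proper_colouring_induced_subgraph_mono[of G "verts G - {b}" 3 \<beta> A] AV b assms(4)
    by (auto simp: delete_vertex_def)
  have nonedge: "{p, l} \<notin> edges H"
    using \<beta> same[OF \<beta>] unfolding proper_colouring_def by blast
  have "\<not> colourable (add_edge H p l) 3"
  proof
    assume "colourable (add_edge H p l) 3"
    then obtain c where "proper_colouring (add_edge H p l) 3 c" by (auto simp: colourable_def)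
    then have "proper_colouring H 3 c" "c p \<noteq> c l"
      by (simp_all add: proper_colouring_def add_edge_def)
    then show False using same by blast
  qed
  then show ?thesis using same nonedge by blast
qed

end
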